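(* Consider the asymmetric log-GARCH$(1,1)$ model $$\epsilon_t=\sigma_t\eta_t,\qquad \log\sigma_t^2=\omega+\left(\alpha_{1+}1_{\{\epsilon_{t-1}>0\}}+\alpha_{1-}1_{\{\epsilon_{t-1}<0\}}\right)\log\epsilon_{t-1}^2+\beta_1\log\sigma_{t-1}^2.$$ Assume that $E\log^+|\log\eta_0^2|<\infty$ and $E|\eta_0|^{2s}<\infty$ for some $s>0$. Assume $\beta_1+\alpha_{1+}\in(0,1)$, $\beta_1+\alpha_{1-}\in(0,1)$ and $\min\{\alpha_{1+},\alpha_{1-}\}>0$. Then, for the strictly stationary solution, $\sigma_0^2$ and $\epsilon_0$ have finite moments of order $s/\max\{\alpha_{1+},\alpha_{1-}\}$ and $2s/\max\{\alpha_{1+},\alpha_{1-},1\}$ respectively, i.e. $E(\sigma_0^2)^{s/\max\{\alpha_{1+},\alpha_{1-}\}}<\infty$ and $E|\epsilon_0|^{2s/\max\{\alpha_{1+},\alpha_{1-},1\}}<\infty$.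
   Context: In the model, $t\in\mathbb{Z}$, $\sigma_t>0$, the coefficients $\omega,\alpha_{1+},\alpha_{1-},\beta_1$ are real, and $(\eta_t)_{t\in\mathbb{Z}}$ is an iid sequence of real random variables with $E\eta_0=0$ and $E\eta_0^2=1$. Convention: $\log0=-\infty$, so $E\log^+|\log\eta_0^2|<\infty$ entails $P(\eta_0=0)=0$. If $E\log^+|\log\eta_0^2|<\infty$ and $|\alpha_{1+}+\beta_1|^a|\alpha_{1-}+\beta_1|^{1-a}<1$ with $a=P(\eta_0>0)$, the model has a unique strictly stationary solution $(\epsilon_t,\sigma_t)_{t\in\mathbb{Z}}$, which is nonanticipative ($\epsilon_t$ is a measurable function of $\{\eta_u:u\le t\}$) and ergodic; this is the solution referred to. *)

theory Defs
  imports "HOL-Probability.Probability"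
begin

text \<open>The library logarithm satisfies \<open>ln 0 = 0\<close>. The moment condition on \<open>log \<eta>\<^sub>0\<^sup>2\<close> relies on the
  convention \<open>log 0 = -\<infinity>\<close>, so the logarithm is extended to \<open>[0, \<infinity>]\<close> (values at negative arguments
  are irrelevant).\<close>

definition elog :: "ereal \<Rightarrow> ereal" where
  "elog x = (if x \<le> 0 then -\<infinity> else if x = \<infinity> then \<infinity> else ereal (ln (real_of_ereal x)))"

definition elog_plus :: "ereal \<Rightarrow> ereal" where
  "elog_plus x = max 0 (elog x)"

definition iid_process :: "'a measure \<Rightarrow> (int \<Rightarrow> 'a \<Rightarrow> real) \<Rightarrow> bool" where
  "iid_process M X \<longleftrightarrow>
     prob_space.indep_vars M (\<lambda>_. borel) X UNIV \<and>
     (\<forall>t. distr M borel (X t) = distr M borel (X 0))"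

text \<open>The law of the whole path, a measure on the product sigma-algebra, is invariant under every
  time shift.\<close>

definition strictly_stationary ::
    "'a measure \<Rightarrow> (int \<Rightarrow> 'a \<Rightarrow> 'b::topological_space) \<Rightarrow> bool" where
  "strictly_stationary M X \<longleftrightarrow>
     (\<forall>t. X t \<in> borel_measurable M) \<and>
     (\<forall>h. distr M (PiM UNIV (\<lambda>_. borel)) (\<lambda>w t. X (t + h) w) =
          distr M (PiM UNIV (\<lambda>_. borel)) (\<lambda>w t. X t w))"

text \<open>When \<open>\<epsilon>\<^sub>t\<^sub>-\<^sub>1 = 0\<close> both indicators vanish, so the value of \<open>ln 0\<close> is immaterial.\<close>

definition log_garch_11_solution ::
    "'a measure \<Rightarrow> (int \<Rightarrow> 'a \<Rightarrow> real) \<Rightarrow> real \<Rightarrow> real \<Rightarrow> real \<Rightarrow> real \<Rightarrow>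
     (int \<Rightarrow> 'a \<Rightarrow> real) \<Rightarrow> (int \<Rightarrow> 'a \<Rightarrow> real) \<Rightarrow> bool" where
  "log_garch_11_solution M \<eta> \<omega> \<alpha>p \<alpha>m \<beta> \<epsilon> \<sigma> \<longleftrightarrow>
     (\<forall>t. AE w in M.
        \<sigma> t w > 0 \<and>
        \<epsilon> t w = \<sigma> t w * \<eta> t w \<and>
        ln ((\<sigma> t w)\<^sup>2) =
          \<omega> + (\<alpha>p * indicator {w. \<epsilon> (t - 1) w > 0} w + \<alpha>m * indicator {w. \<epsilon> (t - 1) w < 0} w)
                * ln ((\<epsilon> (t - 1) w)\<^sup>2)
            + \<beta> * ln ((\<sigma> (t - 1) w)\<^sup>2))"

end

theory Submission
  imports Defs
begin

text \<open>
  Write \<open>H\<^sub>t\<close> for the positive part of \<open>log \<sigma>\<^sub>t\<^sup>2\<close>. As all coefficients \<open>\<alpha> + \<beta>\<close> are positive and bounded by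
  some \<open>\<rho> < 1\<close>, the model gives \<open>H\<^sub>t \<le> B(\<eta>\<^sub>t\<^sub>-\<^sub>1) + \<rho> H\<^sub>t\<^sub>-\<^sub>1\<close> with \<open>B \<ge> 0\<close>, hence
  \<open>H\<^sub>0 \<le> (\<Sum>k<n. \<rho>\<^sup>k B(\<eta>\<^sub>-\<^sub>1\<^sub>-\<^sub>k)) + \<rho>\<^sup>n H\<^sub>-\<^sub>n\<close>. The exponential moment of the sum factorizes by independence
  and is bounded uniformly in \<open>n\<close>, because convexity gives \<open>E exp (r Y) \<le> exp (r (E exp Y - 1))\<close> for
  \<open>r \<in> [0, 1]\<close>. The remainder is at most \<open>1\<close> outside events whose probability tends to \<open>0\<close> by
  stationarity, and such events do not affect a uniform bound. As the bound for \<open>H\<^sub>0\<close> only involves the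
  past of \<open>\<eta>\<close>, no separate argument for the independence of \<open>\<sigma>\<^sub>0\<close> and \<open>\<eta>\<^sub>0\<close> is needed.
\<close>

section \<open>Two integral bounds on a probability space\<close>

text \<open>Truncation at level \<open>K\<close> makes the contribution of \<open>A n\<close> at
  most \<open>K * prob (A n)\<close>, which vanishes for fixed \<open>K\<close>; then
  \<open>K\<close> grows by monotone convergence. Truncating first matters, since finiteness of the
  integral of \<open>f\<close> is what the bound is meant to provide.\<close>

lemma (in prob_space) nn_integral_le_vanishing_events:
  fixes f :: "'a \<Rightarrow> ennreal"
  assumes f [measurable]: "f \<in> borel_measurable M"
    and A [measurable]: "\<And>n. A n \<in> sets M"
    and lim: "(\<lambda>n. prob (A n)) \<longlonglongrightarrow> 0"
    and bound: "\<And>n. (\<integral>\<^sup>+ w. f w * indicator (space M - A n) w \<partial>M) \<le> C"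
  shows "(\<integral>\<^sup>+ w. f w \<partial>M) \<le> C"
proof -
  have trunc: "(\<integral>\<^sup>+ w. min (f w) (of_nat K) \<partial>M) \<le> C" for K :: nat
  proof -
    have le: "(\<integral>\<^sup>+ w. min (f w) (of_nat K) \<partial>M) \<le> C + ennreal (real K * prob (A n))" for n
    proof -
      have "(\<integral>\<^sup>+ w. min (f w) (of_nat K) \<partial>M) \<le>
          (\<integral>\<^sup>+ w. f w * indicator (space M - A n) w + of_nat K * indicator (A n) w \<partial>M)"
        by (intro nn_integral_mono) (auto split: split_indicator)
      also have "\<dots> = (\<integral>\<^sup>+ w. f w * indicator (space M - A n) w \<partial>M) + of_nat K * emeasure M (A n)"
        by (subst nn_integral_add) (auto simp: nn_integral_cmult_indicator)
      also have "\<dots> \<le> C + of_nat K * emeasure M (A n)"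
        by (intro add_right_mono bound)
      also have "of_nat K * emeasure M (A n) = ennreal (real K * prob (A n))"
        by (simp add: emeasure_eq_measure ennreal_mult ennreal_of_nat_eq_real_of_nat)
      finally show ?thesis .
    qed
    have "(\<lambda>n. real K * prob (A n)) \<longlonglongrightarrow> 0"
      using tendsto_mult_left[OF lim, of "real K"] by simp
    then have "(\<lambda>n. C + ennreal (real K * prob (A n))) \<longlonglongrightarrow> C + ennreal 0"
      by (intro tendsto_add tendsto_const tendsto_ennrealI)
    then show ?thesis
      using le by (intro LIMSEQ_le_const[where X = "\<lambda>n. C + ennreal (real K * prob (A n))"]) auto
  qed
  have "f w = (SUP K. min (f w) (of_nat K))" for w
    by (simp add: inf_min[symmetric] ennreal_SUP_of_nat_eq_top flip: inf_SUP)
  then have "(\<integral>\<^sup>+ w. f w \<partial>M) = (\<integral>\<^sup>+ w. (SUP K. min (f w) (of_nat K)) \<partial>M)"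
    by presburger
  also have "\<dots> = (SUP K. \<integral>\<^sup>+ w. min (f w) (of_nat K) \<partial>M)"
    by (intro nn_integral_monotone_convergence_SUP)
      (auto simp: incseq_def le_fun_def intro!: min.coboundedI2 of_nat_mono)
  also have "\<dots> \<le> C"
    by (intro SUP_least trunc)
  finally show ?thesis .
qed

lemma exp_scale_le:
  fixes r y :: real
  assumes "0 \<le> r" "r \<le> 1"
  shows "exp (r * y) \<le> 1 + r * (exp y - 1)"
proof -
  have "exp ((1 - r) *\<^sub>R 0 + r *\<^sub>R y) \<le> (1 - r) * exp 0 + r * exp y"
    using assms by (intro convex_onD[OF exp_convex]) auto
  then show ?thesis
    by (simp add: algebra_simps)
qed

text \<open>The chord bound for \<open>exp\<close> is linear in \<open>exp (Y w)\<close> and can be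
  integrated; \<open>1 + u \<le> exp u\<close> then moves \<open>r\<close> into the exponent. In
  this form the bounds for \<open>r = \<rho> ^ k\<close> multiply to a geometric series in the
  exponent, uniformly in the number of factors.\<close>

lemma (in prob_space) nn_integral_exp_scale_le:
  fixes Y :: "'a \<Rightarrow> real"
  assumes Y [measurable]: "Y \<in> borel_measurable M" and nonneg: "\<And>w. 0 \<le> Y w"
    and m: "(\<integral>\<^sup>+ w. ennreal (exp (Y w)) \<partial>M) = ennreal m"
    and r: "0 \<le> r" "r \<le> 1"
  shows "(\<integral>\<^sup>+ w. ennreal (exp (r * Y w)) \<partial>M) \<le> ennreal (exp (r * (m - 1)))"
proof -
  have "(\<integral>\<^sup>+ w. 1 \<partial>M) \<le> (\<integral>\<^sup>+ w. ennreal (exp (Y w)) \<partial>M)"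
    using nonneg by (intro nn_integral_mono) (simp add: ennreal_ge_1)
  then have m1: "1 \<le> m"
    by (simp add: m emeasure_space_1 ennreal_ge_1)
  have "(\<integral>\<^sup>+ w. ennreal (exp (r * Y w)) \<partial>M) \<le>
      (\<integral>\<^sup>+ w. ennreal (1 - r) + ennreal r * ennreal (exp (Y w)) \<partial>M)"
  proof (rule nn_integral_mono)
    fix w
    have "ennreal (exp (r * Y w)) \<le> ennreal ((1 - r) + r * exp (Y w))"
      using exp_scale_le[OF r, of "Y w"] by (intro ennreal_leI) (simp add: algebra_simps)
    then show "ennreal (exp (r * Y w)) \<le> ennreal (1 - r) + ennreal r * ennreal (exp (Y w))"
      using r by (simp add: ennreal_plus ennreal_mult)
  qed
  also have "\<dots> = ennreal (1 - r) + ennreal r * ennreal m"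
    by (simp add: nn_integral_add nn_integral_cmult m emeasure_space_1)
  also have "\<dots> = ennreal (1 + r * (m - 1))"
    using r m1 by (simp add: algebra_simps flip: ennreal_plus ennreal_mult)
  also have "\<dots> \<le> ennreal (exp (r * (m - 1)))"
    by (intro ennreal_leI exp_ge_add_one_self)
  finally show ?thesis .
qed

section \<open>Exponential moments of geometric sums of iid variables\<close>

lemma iid_process_measurable:
  assumes "prob_space M" "iid_process M X"
  shows "X t \<in> borel_measurable M"
proof -
  interpret prob_space M by fact
  show ?thesis
    using assms(2) by (auto simp: iid_process_def indep_vars_def2)
qed

lemma nn_integral_iid_process:
  fixes F :: "real \<Rightarrow> ennreal"
  assumes "prob_space M" "iid_process M X" and F: "F \<in> borel_measurable borel"
  shows "(\<integral>\<^sup>+ w. F (X t w) \<partial>M) = (\<integral>\<^sup>+ w. F (X 0 w) \<partial>M)"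
proof -
  have "(\<integral>\<^sup>+ w. F (X u w) \<partial>M) = (\<integral>\<^sup>+ x. F x \<partial>distr M borel (X u))" for u
    using iid_process_measurable[OF assms(1,2), of u] F by (simp add: nn_integral_distr)
  moreover have "distr M borel (X t) = distr M borel (X 0)"
    using assms(2) unfolding iid_process_def by blast
  ultimately show ?thesis
    by metis
qed

text \<open>The sum involves only negative times, so \<open>g (X 0 w)\<close> is one more
  independent factor. Carrying it along later lets a power of the current innovation be integrated
  together with the bound for the volatility.\<close>

lemma nn_integral_exp_geometric_sum_le:
  fixes X :: "int \<Rightarrow> 'a \<Rightarrow> real" and B :: "real \<Rightarrow> real" and g :: "real \<Rightarrow> ennreal"
  assumes "prob_space M" and iid: "iid_process M X"
    and B [measurable]: "B \<in> borel_measurable borel" and nonneg: "\<And>x. 0 \<le> B x"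
    and g [measurable]: "g \<in> borel_measurable borel"
    and m: "(\<integral>\<^sup>+ w. ennreal (exp (B (X 0 w))) \<partial>M) = ennreal m"
    and \<rho>: "0 \<le> \<rho>" "\<rho> < 1"
  shows "(\<integral>\<^sup>+ w. g (X 0 w) * ennreal (exp (\<Sum>k<n. \<rho> ^ k * B (X (- 1 - int k) w))) \<partial>M)
      \<le> (\<integral>\<^sup>+ w. g (X 0 w) \<partial>M) * ennreal (exp ((m - 1) / (1 - \<rho>)))"
proof -
  interpret prob_space M by fact
  note [measurable] = iid_process_measurable[OF \<open>prob_space M\<close> iid]
  have "(\<integral>\<^sup>+ w. 1 \<partial>M) \<le> (\<integral>\<^sup>+ w. ennreal (exp (B (X 0 w))) \<partial>M)"
    using nonneg by (intro nn_integral_mono) (simp add: ennreal_ge_1)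
  then have m1: "1 \<le> m"
    by (simp add: m emeasure_space_1 ennreal_ge_1)
  \<comment> \<open>Index \<open>0\<close> holds the factor \<open>g\<close> at time
    \<open>0\<close>; index \<open>Suc j\<close> holds the factor of weight
    \<open>\<rho> ^ j\<close> at time \<open>- 1 - j\<close>. Thus \<open>F k\<close> always acts at
    time \<open>- k\<close>, and \<open>nat (- t)\<close> recovers the index from the time.\<close>
  define F where "F k = (case k of 0 \<Rightarrow> g | Suc j \<Rightarrow> (\<lambda>x. ennreal (exp (\<rho> ^ j * B x))))" for k
  have F [measurable]: "F k \<in> borel_measurable borel" for k
    by (cases k) (auto simp: F_def)
  let ?J = "(\<lambda>k. - int k) ` {..n}"
  have inj: "inj_on (\<lambda>k. - int k) {..n}"
    by (auto simp: inj_on_def)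
  have "indep_vars (\<lambda>_. borel) X ?J"
    using iid unfolding iid_process_def by (blast intro: indep_vars_subset[OF _ subset_UNIV])
  then have indep: "indep_vars (\<lambda>_. borel) (\<lambda>t w. F (nat (- t)) (X t w)) ?J"
    by (rule indep_vars_compose2) simp
  have "(\<integral>\<^sup>+ w. g (X 0 w) * ennreal (exp (\<Sum>k<n. \<rho> ^ k * B (X (- 1 - int k) w))) \<partial>M)
      = (\<integral>\<^sup>+ w. (\<Prod>k\<le>n. F k (X (- int k) w)) \<partial>M)"
    by (simp add: prod.atMost_shift F_def exp_sum prod_ennreal)
  also have "\<dots> = (\<Prod>k\<le>n. \<integral>\<^sup>+ w. F k (X (- int k) w) \<partial>M)"
    using indep_vars_nn_integral[OF _ indep] by (simp add: prod.reindex[OF inj])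
  also have "\<dots> = (\<Prod>k\<le>n. \<integral>\<^sup>+ w. F k (X 0 w) \<partial>M)"
    by (intro prod.cong refl nn_integral_iid_process[OF \<open>prob_space M\<close> iid] F)
  also have "\<dots> = (\<integral>\<^sup>+ w. g (X 0 w) \<partial>M) *
      (\<Prod>k<n. \<integral>\<^sup>+ w. ennreal (exp (\<rho> ^ k * B (X 0 w))) \<partial>M)"
    by (simp add: prod.atMost_shift F_def)
  also have "\<dots> \<le> (\<integral>\<^sup>+ w. g (X 0 w) \<partial>M) * (\<Prod>k<n. ennreal (exp (\<rho> ^ k * (m - 1))))"
    using \<rho> nonneg m
    by (intro mult_left_mono prod_mono_ennreal nn_integral_exp_scale_le) (auto simp: power_le_one)
  also have "(\<Prod>k<n. ennreal (exp (\<rho> ^ k * (m - 1)))) = ennreal (exp ((\<Sum>k<n. \<rho> ^ k) * (m - 1)))"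
    by (simp add: prod_ennreal exp_sum sum_distrib_right)
  also have "\<dots> \<le> ennreal (exp ((m - 1) / (1 - \<rho>)))"
  proof -
    \<comment> \<open>Multiplying by \<open>m - 1\<close> preserves this inequality because
      \<open>m \<ge> 1\<close>, which comes from \<open>B \<ge> 0\<close>.\<close>
    have "(\<Sum>k<n. \<rho> ^ k) \<le> 1 / (1 - \<rho>)"
      using \<rho> by (simp add: sum_gp_strict divide_right_mono)
    then show ?thesis
      using m1 mult_right_mono[of "\<Sum>k<n. \<rho> ^ k" "1 / (1 - \<rho>)" "m - 1"]
      by (intro ennreal_leI) simp
  qed
  finally show ?thesis
    by (simp add: mult_left_mono)
qed

section \<open>Marginals of a stationary process\<close>

text \<open>The law of \<open>X h\<close> is the image of the law of the path shifted by
  \<open>h\<close> under evaluation at time \<open>0\<close>, and the latter law is the same for all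
  \<open>h\<close>.\<close>

lemma strictly_stationary_distr:
  fixes X :: "int \<Rightarrow> 'a \<Rightarrow> 'b::topological_space"
  assumes "strictly_stationary M X"
  shows "distr M borel (X t) = distr M borel (X 0)"
proof -
  have [measurable]: "X u \<in> borel_measurable M" for u
    using assms by (simp add: strictly_stationary_def)
  have path: "(\<lambda>w u. X (u + h) w) \<in> measurable M (PiM UNIV (\<lambda>_. borel))" for h
    by (rule measurable_PiM_single') auto
  have "distr M borel (X h) = distr (distr M (PiM UNIV (\<lambda>_. borel)) (\<lambda>w u. X (u + h) w)) borel (\<lambda>f. f 0)"
    for h
    using path[of h] by (subst distr_distr) (auto simp: comp_def)
  from this[of t] this[of 0] show ?thesis
    using assms by (simp add: strictly_stationary_def)
qed

lemma strictly_stationary_Pair_measurable: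
  fixes X :: "int \<Rightarrow> 'a \<Rightarrow> 'b::topological_space" and Y :: "int \<Rightarrow> 'a \<Rightarrow> 'c::topological_space"
  assumes "strictly_stationary M (\<lambda>t w. (X t w, Y t w))"
  shows "X t \<in> borel_measurable M" "Y t \<in> borel_measurable M"
proof -
  have *: "(\<lambda>w. (X t w, Y t w)) \<in> borel_measurable M"
    using assms by (simp add: strictly_stationary_def)
  show "X t \<in> borel_measurable M" "Y t \<in> borel_measurable M"
    using borel_measurable_continuous_on[OF continuous_on_fst[OF continuous_on_id] *]
      borel_measurable_continuous_on[OF continuous_on_snd[OF continuous_on_id] *] by auto
qed

section \<open>Pointwise estimates for the log-GARCH recursion\<close>

lemma powr_le_1_plus_powr:
  fixes x a b :: real
  assumes "0 \<le> x" "0 \<le> a" "a \<le> b"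
  shows "x powr a \<le> 1 + x powr b"
proof (cases "x \<le> 1")
  case True
  then have "x powr a \<le> 1"
    using assms powr_mono2[of a x 1] by simp
  then show ?thesis
    by (simp add: add_increasing2)
next
  case False
  then have "x powr a \<le> x powr b"
    using assms by (intro powr_mono) auto
  then show ?thesis
    by linarith
qed

text \<open>Substituting \<open>\<epsilon> = \<sigma> x\<close> in the model leaves this term
  depending on \<open>x\<close> alone, since \<open>\<epsilon>\<close> and \<open>x\<close> have the
  same sign when \<open>\<sigma> > 0\<close>. The positive part is what a recursion for the positive
  part of the log-volatility requires.\<close>

definition garch_shock :: "real \<Rightarrow> real \<Rightarrow> real \<Rightarrow> real \<Rightarrow> real" where
  "garch_shock \<omega> \<alpha>p \<alpha>m x = max 0 (\<omega> + (if x > 0 then \<alpha>p else if x < 0 then \<alpha>m else 0) * ln (x\<^sup>2))"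

lemma garch_shock_measurable [measurable]: "garch_shock \<omega> \<alpha>p \<alpha>m \<in> borel_measurable borel"
  unfolding garch_shock_def by measurable

lemma garch_shock_nonneg: "0 \<le> garch_shock \<omega> \<alpha>p \<alpha>m x"
  by (simp add: garch_shock_def)

text \<open>For \<open>x \<noteq> 0\<close> the exponential of \<open>p * a * ln (x\<^sup>2)\<close>
  is the power of |x| of order \<open>2 * p * a\<close>, and \<open>p * a \<le> s\<close> lets the
  moment of order \<open>2 * s\<close> dominate it. This is where the admissible order
  \<open>p\<close> is tied to the coefficients.\<close>

lemma exp_garch_shock_le:
  assumes p: "0 \<le> p" "p * \<alpha>p \<le> s" "p * \<alpha>m \<le> s" and "0 < \<alpha>p" "0 < \<alpha>m"
  shows "exp (p * garch_shock \<omega> \<alpha>p \<alpha>m x) \<le> 1 + exp (p * \<omega>) * (1 + \<bar>x\<bar> powr (2 * s))"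
proof -
  define a where "a = (if x > 0 then \<alpha>p else if x < 0 then \<alpha>m else 0)"
  have a: "0 \<le> p * a" "p * a \<le> s"
    using assms order_trans[of 0 "p * \<alpha>p" s] by (auto simp: a_def)
  have *: "exp (p * (a * ln (x\<^sup>2))) \<le> 1 + \<bar>x\<bar> powr (2 * s)"
  proof (cases "x = 0")
    case False
    then have "ln (x\<^sup>2) = 2 * ln \<bar>x\<bar>"
      using ln_realpow[of "\<bar>x\<bar>" 2] by simp
    with False have "exp (p * (a * ln (x\<^sup>2))) = \<bar>x\<bar> powr (2 * (p * a))"
      by (simp add: powr_def)
    then show ?thesis
      using powr_le_1_plus_powr[of "\<bar>x\<bar>" "2 * (p * a)" "2 * s"] a by simp
  qed (simp add: a_def)
  have "exp (p * garch_shock \<omega> \<alpha>p \<alpha>m x) \<le> 1 + exp (p * (\<omega> + a * ln (x\<^sup>2)))"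
    by (auto simp: garch_shock_def a_def[symmetric] max_def)
  also have "exp (p * (\<omega> + a * ln (x\<^sup>2))) = exp (p * \<omega>) * exp (p * (a * ln (x\<^sup>2)))"
    by (simp add: exp_add distrib_left)
  also have "\<dots> \<le> exp (p * \<omega>) * (1 + \<bar>x\<bar> powr (2 * s))"
    by (intro mult_left_mono *) auto
  finally show ?thesis
    by simp
qed

text \<open>Splitting \<open>ln (\<epsilon>\<^sup>2)\<close> gives the old log-volatility the
  coefficient \<open>\<beta> + a\<close>, which lies between \<open>0\<close> and
  \<open>\<rho>\<close>, so passing to positive parts is monotone. At \<open>x = 0\<close> the
  coefficient would be \<open>\<beta>\<close> alone, which may be negative.\<close>

lemma log_garch_step:
  fixes \<epsilon> \<sigma> \<sigma>' x :: real
  assumes "0 < \<sigma>" "\<epsilon> = \<sigma> * x" "x \<noteq> 0"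
    and "ln (\<sigma>'\<^sup>2) = \<omega> + (\<alpha>p * of_bool (\<epsilon> > 0) + \<alpha>m * of_bool (\<epsilon> < 0)) * ln (\<epsilon>\<^sup>2) + \<beta> * ln (\<sigma>\<^sup>2)"
    and "0 \<le> \<beta> + \<alpha>p" "\<beta> + \<alpha>p \<le> \<rho>" "0 \<le> \<beta> + \<alpha>m" "\<beta> + \<alpha>m \<le> \<rho>"
  shows "max 0 (ln (\<sigma>'\<^sup>2)) \<le> garch_shock \<omega> \<alpha>p \<alpha>m x + \<rho> * max 0 (ln (\<sigma>\<^sup>2))"
proof -
  define a where "a = (if x > 0 then \<alpha>p else \<alpha>m)"
  have a: "0 \<le> \<beta> + a" "\<beta> + a \<le> \<rho>"
    using assms by (auto simp: a_def)
  have coeff: "\<alpha>p * of_bool (\<epsilon> > 0) + \<alpha>m * of_bool (\<epsilon> < 0) = a"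
    using assms(1-3) by (auto simp: a_def zero_less_mult_iff mult_less_0_iff)
  have "ln (\<epsilon>\<^sup>2) = ln (\<sigma>\<^sup>2) + ln (x\<^sup>2)"
    using assms(1-3) by (simp add: power_mult_distrib ln_mult)
  then have "ln (\<sigma>'\<^sup>2) = (\<omega> + a * ln (x\<^sup>2)) + (\<beta> + a) * ln (\<sigma>\<^sup>2)"
    using assms(4) unfolding coeff by (simp add: algebra_simps)
  moreover have "\<omega> + a * ln (x\<^sup>2) \<le> garch_shock \<omega> \<alpha>p \<alpha>m x"
    using assms(3) by (auto simp: garch_shock_def a_def)
  moreover have "(\<beta> + a) * ln (\<sigma>\<^sup>2) \<le> (\<beta> + a) * max 0 (ln (\<sigma>\<^sup>2))"
    using a by (intro mult_left_mono) auto
  moreover have "(\<beta> + a) * max 0 (ln (\<sigma>\<^sup>2)) \<le> \<rho> * max 0 (ln (\<sigma>\<^sup>2))"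
    using a by (intro mult_right_mono) auto
  moreover have "0 \<le> garch_shock \<omega> \<alpha>p \<alpha>m x" "0 \<le> \<rho> * max 0 (ln (\<sigma>\<^sup>2))"
    using a by (auto simp: garch_shock_nonneg)
  ultimately show ?thesis
    by linarith
qed

lemma geometric_recursion_le:
  fixes H b :: "int \<Rightarrow> real"
  assumes step: "\<And>t. H t \<le> b (t - 1) + \<rho> * H (t - 1)" and "0 \<le> \<rho>"
  shows "H 0 \<le> (\<Sum>k<n. \<rho> ^ k * b (- 1 - int k)) + \<rho> ^ n * H (- int n)"
proof (induction n)
  case (Suc n)
  have "H (- int n) \<le> b (- 1 - int n) + \<rho> * H (- 1 - int n)"
    using step[of "- int n"] by (simp only: minus_diff_commute[of 1 "int n"])
  then have "\<rho> ^ n * H (- int n) \<le> \<rho> ^ n * (b (- 1 - int n) + \<rho> * H (- 1 - int n))"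
    using \<open>0 \<le> \<rho>\<close> by (intro mult_left_mono) auto
  moreover have "- int (Suc n) = - 1 - int n"
    by simp
  ultimately show ?case
    using Suc by (simp add: distrib_left mult_ac)
qed simp

section \<open>Vanishing and null events\<close>

lemma (in prob_space) prob_exceeds_vanishing:
  fixes Y :: "'a \<Rightarrow> real"
  assumes [measurable]: "Y \<in> borel_measurable M" and \<rho>: "0 \<le> \<rho>" "\<rho> < 1"
  shows "(\<lambda>n. prob {w \<in> space M. \<rho> ^ n * Y w > 1}) \<longlonglongrightarrow> 0"
proof -
  have "(\<lambda>n. expectation (indicator {w \<in> space M. \<rho> ^ n * Y w > 1} :: 'a \<Rightarrow> real))
      \<longlonglongrightarrow> expectation (\<lambda>w. 0 :: real)"
  proof (rule integral_dominated_convergence[where w = "\<lambda>_. 1"])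
    show "AE w in M. (\<lambda>n. indicator {w \<in> space M. \<rho> ^ n * Y w > 1} w :: real) \<longlonglongrightarrow> 0"
    proof (rule AE_I2)
      fix w
      have "(\<lambda>n. \<rho> ^ n * Y w) \<longlonglongrightarrow> 0"
        using tendsto_mult_right[OF LIMSEQ_realpow_zero[OF \<rho>], of "Y w"] by simp
      then have "\<forall>\<^sub>F n in sequentially. \<rho> ^ n * Y w < 1"
        by (rule order_tendstoD) simp
      then show "(\<lambda>n. indicator {w \<in> space M. \<rho> ^ n * Y w > 1} w :: real) \<longlonglongrightarrow> 0"
        by (intro tendsto_eventually) (auto elim!: eventually_mono split: split_indicator)
    qed
  qed (auto split: split_indicator)
  then show ?thesis
    by simp
qed

text \<open>With log 0 = -infinity the integrand is infinite wherever \<open>f\<close> vanishes, so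
  a finite integral forces that set to be null.\<close>

lemma AE_nonzero_if_log_moment:
  fixes f :: "'a \<Rightarrow> real"
  assumes [measurable]: "f \<in> borel_measurable M"
    and fin: "(\<integral>\<^sup>+ w. e2ennreal (elog_plus \<bar>elog (ereal ((f w)\<^sup>2))\<bar>) \<partial>M) < \<infinity>"
  shows "AE w in M. f w \<noteq> 0"
proof -
  let ?N = "{w \<in> space M. f w = 0}"
  have "\<infinity> * emeasure M ?N = (\<integral>\<^sup>+ w. \<infinity> * indicator ?N w \<partial>M)"
    by (subst nn_integral_cmult_indicator) auto
  also have "\<dots> \<le> (\<integral>\<^sup>+ w. e2ennreal (elog_plus \<bar>elog (ereal ((f w)\<^sup>2))\<bar>) \<partial>M)"
    by (intro nn_integral_mono) (auto simp: elog_plus_def elog_def split: split_indicator)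
  also have "\<dots> < \<infinity>"
    by fact
  finally have "emeasure M ?N = 0"
    by (auto simp: ennreal_top_mult split: if_splits)
  then show ?thesis
    by (subst AE_iff_measurable[OF _ refl]) auto
qed

section \<open>The joint moment bound and the two moment orders\<close>

text \<open>Both claims are instances: \<open>q = 0\<close> gives the volatility, and
  \<open>p = q\<close> gives the observation, because \<open>\<epsilon> = \<sigma> * \<eta>\<close>
  almost surely.\<close>

lemma log_garch_moment:
  fixes \<eta> \<epsilon> \<sigma> :: "int \<Rightarrow> 'a \<Rightarrow> real"
  assumes prob: "prob_space M" and iid: "iid_process M \<eta>"
    and log_moment: "(\<integral>\<^sup>+ w. e2ennreal (elog_plus \<bar>elog (ereal ((\<eta> 0 w)\<^sup>2))\<bar>) \<partial>M) < \<infinity>"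
    and moment: "integrable M (\<lambda>w. \<bar>\<eta> 0 w\<bar> powr (2 * s))"
    and \<alpha>\<beta>: "\<beta> + \<alpha>p \<in> {0<..<1}" "\<beta> + \<alpha>m \<in> {0<..<1}" and \<alpha>: "0 < \<alpha>p" "0 < \<alpha>m"
    and sol: "log_garch_11_solution M \<eta> \<omega> \<alpha>p \<alpha>m \<beta> \<epsilon> \<sigma>"
    and stat: "strictly_stationary M (\<lambda>t w. (\<epsilon> t w, \<sigma> t w))"
    and p: "0 \<le> p" "p * \<alpha>p \<le> s" "p * \<alpha>m \<le> s" and q: "0 \<le> q" "q \<le> s"
  shows "integrable M (\<lambda>w. ((\<sigma> 0 w)\<^sup>2) powr p * \<bar>\<eta> 0 w\<bar> powr (2 * q))"
proof -
  interpret prob_space M by fact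
  note \<eta> [measurable] = iid_process_measurable[OF prob iid]
  note [measurable] = strictly_stationary_Pair_measurable[OF stat]
  define \<rho> where "\<rho> = max (\<beta> + \<alpha>p) (\<beta> + \<alpha>m)"
  have \<rho>: "0 \<le> \<rho>" "\<rho> < 1"
    using \<alpha>\<beta> by (auto simp: \<rho>_def)
  define B where "B = garch_shock \<omega> \<alpha>p \<alpha>m"
  have B [measurable]: "B \<in> borel_measurable borel" and B0: "0 \<le> B x" for x
    by (auto simp: B_def garch_shock_nonneg)
  define H where "H t w = max 0 (ln ((\<sigma> t w)\<^sup>2))" for t w
  have [measurable]: "H t \<in> borel_measurable M" for t
    unfolding H_def by measurable
  define g :: "real \<Rightarrow> ennreal" where "g x = ennreal (\<bar>x\<bar> powr (2 * q))" for x
  have g [measurable]: "g \<in> borel_measurable borel"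
    unfolding g_def by measurable

  \<comment> \<open>The log moment is given at time \<open>0\<close> only; the equal laws carry the
    null event to every time.\<close>
  have nz: "AE w in M. \<forall>t. \<eta> t w \<noteq> 0"
    unfolding AE_all_countable
  proof
    fix t
    have "(\<integral>\<^sup>+ w. indicator {0} (\<eta> t w) \<partial>M) = (\<integral>\<^sup>+ w. indicator {0} (\<eta> 0 w) \<partial>M)"
      by (rule nn_integral_iid_process[OF prob iid]) auto
    also have "\<dots> = 0"
      using AE_nonzero_if_log_moment[OF \<eta> log_moment]
      by (subst nn_integral_0_iff_AE) (auto elim!: eventually_mono)
    finally show "AE w in M. \<eta> t w \<noteq> 0"
      by (subst (asm) nn_integral_0_iff_AE) (auto simp: indicator_def)
  qed
  have "AE w in M. \<forall>t. \<sigma> t w > 0 \<and> \<epsilon> t w = \<sigma> t w * \<eta> t w \<and>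
      ln ((\<sigma> t w)\<^sup>2) = \<omega> + (\<alpha>p * of_bool (\<epsilon> (t - 1) w > 0) + \<alpha>m * of_bool (\<epsilon> (t - 1) w < 0))
        * ln ((\<epsilon> (t - 1) w)\<^sup>2) + \<beta> * ln ((\<sigma> (t - 1) w)\<^sup>2)"
    using sol unfolding log_garch_11_solution_def AE_all_countable by (simp add: indicator_def)
  with nz have iter: "AE w in M. \<forall>n. H 0 w \<le>
      (\<Sum>k<n. \<rho> ^ k * B (\<eta> (- 1 - int k) w)) + \<rho> ^ n * H (- int n) w"
  proof eventually_elim
    case (elim w)
    have "H t w \<le> B (\<eta> (t - 1) w) + \<rho> * H (t - 1) w" for t
    proof -
      note sol_t = spec[OF elim(2), of t] and sol_t' = spec[OF elim(2), of "t - 1"]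
      show ?thesis
        unfolding H_def B_def
        by (rule log_garch_step[OF _ _ spec[OF elim(1)], where \<epsilon> = "\<epsilon> (t - 1) w" and \<beta> = \<beta>])
          (use sol_t sol_t' \<alpha>\<beta> in \<open>simp_all add: \<rho>_def\<close>)
    qed
    then show ?case
      using geometric_recursion_le[of "\<lambda>t. H t w" "\<lambda>t. B (\<eta> t w)" \<rho>] \<rho> by auto
  qed

  have fin: "(\<integral>\<^sup>+ w. ennreal (exp (p * B (\<eta> 0 w))) \<partial>M) < \<infinity>"
  proof -
    have "(\<integral>\<^sup>+ w. ennreal (exp (p * B (\<eta> 0 w))) \<partial>M) \<le>
        (\<integral>\<^sup>+ w. ennreal (1 + exp (p * \<omega>) * (1 + \<bar>\<eta> 0 w\<bar> powr (2 * s))) \<partial>M)"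
      unfolding B_def using p \<alpha> by (intro nn_integral_mono ennreal_leI exp_garch_shock_le) auto
    also have "\<dots> < \<infinity>"
      using moment by (subst nn_integral_eq_integral) auto
    finally show ?thesis .
  qed
  then obtain m where m: "(\<integral>\<^sup>+ w. ennreal (exp (p * B (\<eta> 0 w))) \<partial>M) = ennreal m"
    by (cases "\<integral>\<^sup>+ w. ennreal (exp (p * B (\<eta> 0 w))) \<partial>M") auto
  have g_fin: "(\<integral>\<^sup>+ w. g (\<eta> 0 w) \<partial>M) < \<infinity>"
  proof -
    have "(\<integral>\<^sup>+ w. g (\<eta> 0 w) \<partial>M) \<le> (\<integral>\<^sup>+ w. ennreal (1 + \<bar>\<eta> 0 w\<bar> powr (2 * s)) \<partial>M)"
      unfolding g_def using q by (intro nn_integral_mono ennreal_leI powr_le_1_plus_powr) auto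
    also have "\<dots> < \<infinity>"
      using moment by (subst nn_integral_eq_integral) auto
    finally show ?thesis .
  qed

  \<comment> \<open>Off \<open>A n\<close> the remainder of the iterated recursion is at most
    \<open>1\<close>, which costs only the factor \<open>exp p\<close> in \<open>C\<close>.\<close>
  define A where "A n = {w \<in> space M. \<rho> ^ n * H (- int n) w > 1}" for n
  have A [measurable]: "A n \<in> sets M" for n
    unfolding A_def by measurable
  have "prob (A n) = prob {w \<in> space M. \<rho> ^ n * H 0 w > 1}" for n
  proof -
    \<comment> \<open>Stationarity is assumed for the pair, so the event is expressed as a Borel set
      of pairs. This replaces \<open>H (- int n)\<close>, which changes with \<open>n\<close>, by
      the fixed variable \<open>H 0\<close>.\<close>
    define S where "S = {x :: real \<times> real. \<rho> ^ n * max 0 (ln ((snd x)\<^sup>2)) > 1}"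
    have S: "S \<in> sets borel"
    proof -
      have "{x \<in> space (borel \<Otimes>\<^sub>M borel). \<rho> ^ n * max 0 (ln ((snd x :: real)\<^sup>2)) > 1}
          \<in> sets ((borel :: real measure) \<Otimes>\<^sub>M borel)"
        by measurable
      then show ?thesis
        unfolding borel_prod by (simp add: S_def)
    qed
    have "prob {w \<in> space M. \<rho> ^ n * H t w > 1} =
        measure (distr M borel (\<lambda>w. (\<epsilon> t w, \<sigma> t w))) S" for t
    proof -
      have "(\<lambda>w. (\<epsilon> t w, \<sigma> t w)) \<in> borel_measurable M"
        using stat by (simp add: strictly_stationary_def)
      from measure_distr[OF this S] show ?thesis
        by (simp add: S_def H_def vimage_def Int_def conj_commute)
    qed
    then show ?thesis
      using strictly_stationary_distr[OF stat, of "- int n"] by (simp add: A_def)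
  qed
  then have lim: "(\<lambda>n. prob (A n)) \<longlonglongrightarrow> 0"
    using prob_exceeds_vanishing[of "H 0", OF _ \<rho>] by simp

  define C where "C = ennreal (exp p) * ((\<integral>\<^sup>+ w. g (\<eta> 0 w) \<partial>M) * ennreal (exp ((m - 1) / (1 - \<rho>))))"
  have "(\<integral>\<^sup>+ w. ennreal (exp (p * H 0 w)) * g (\<eta> 0 w) \<partial>M) \<le> C"
  proof (rule nn_integral_le_vanishing_events[OF _ A lim])
    fix n
    let ?S = "\<lambda>w. \<Sum>k<n. \<rho> ^ k * (p * B (\<eta> (- 1 - int k) w))"
    have "(\<integral>\<^sup>+ w. ennreal (exp (p * H 0 w)) * g (\<eta> 0 w) * indicator (space M - A n) w \<partial>M) \<le>
        (\<integral>\<^sup>+ w. ennreal (exp p) * (g (\<eta> 0 w) * ennreal (exp (?S w))) \<partial>M)"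
    proof (rule nn_integral_mono_AE)
      show "AE w in M. ennreal (exp (p * H 0 w)) * g (\<eta> 0 w) * indicator (space M - A n) w \<le>
          ennreal (exp p) * (g (\<eta> 0 w) * ennreal (exp (?S w)))"
        using iter
      proof eventually_elim
        case (elim w)
        show ?case
        proof (cases "w \<in> space M - A n")
          case True
          then have "\<rho> ^ n * H (- int n) w \<le> 1"
            by (auto simp: A_def)
          with elim have "H 0 w \<le> (\<Sum>k<n. \<rho> ^ k * B (\<eta> (- 1 - int k) w)) + 1"
            by (meson add_left_mono order_trans)
          then have "p * H 0 w \<le> p * ((\<Sum>k<n. \<rho> ^ k * B (\<eta> (- 1 - int k) w)) + 1)"
            using p by (intro mult_left_mono)
          also have "\<dots> = p + ?S w"
            by (simp add: distrib_left sum_distrib_left mult_ac)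
          finally have "exp (p * H 0 w) \<le> exp p * exp (?S w)"
            by (simp flip: exp_add)
          then have "ennreal (exp (p * H 0 w)) \<le> ennreal (exp p) * ennreal (exp (?S w))"
            by (simp add: ennreal_leI flip: ennreal_mult)
          from mult_right_mono[OF this, of "g (\<eta> 0 w)"] True show ?thesis
            by (simp add: mult_ac)
        qed simp
      qed
    qed
    also have "\<dots> = ennreal (exp p) * (\<integral>\<^sup>+ w. g (\<eta> 0 w) * ennreal (exp (?S w)) \<partial>M)"
      by (rule nn_integral_cmult) measurable
    also have "\<dots> \<le> C"
      unfolding C_def using \<rho> p B0 m
      by (intro mult_left_mono nn_integral_exp_geometric_sum_le[OF prob iid]) auto
    finally show "(\<integral>\<^sup>+ w. ennreal (exp (p * H 0 w)) * g (\<eta> 0 w) * indicator (space M - A n) w \<partial>M)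
        \<le> C" .
  qed measurable
  also have "C < \<infinity>"
    using g_fin by (simp add: C_def ennreal_mult_less_top)
  finally have bound: "(\<integral>\<^sup>+ w. ennreal (exp (p * H 0 w)) * g (\<eta> 0 w) \<partial>M) < \<infinity>" .
  have "(\<integral>\<^sup>+ w. ennreal (((\<sigma> 0 w)\<^sup>2) powr p * \<bar>\<eta> 0 w\<bar> powr (2 * q)) \<partial>M) \<le>
      (\<integral>\<^sup>+ w. ennreal (exp (p * H 0 w)) * g (\<eta> 0 w) \<partial>M)"
  proof (rule nn_integral_mono)
    fix w
    \<comment> \<open>This holds at every \<open>w\<close>: where \<open>\<sigma> 0 w = 0\<close>,
      the left side is \<open>0\<close> by the convention for \<open>powr\<close>.\<close>
    have "((\<sigma> 0 w)\<^sup>2) powr p \<le> exp (p * H 0 w)"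
      using p by (auto simp: powr_def H_def intro!: mult_left_mono)
    then show "ennreal (((\<sigma> 0 w)\<^sup>2) powr p * \<bar>\<eta> 0 w\<bar> powr (2 * q))
        \<le> ennreal (exp (p * H 0 w)) * g (\<eta> 0 w)"
      by (auto simp: g_def ennreal_leI mult_right_mono simp flip: ennreal_mult)
  qed
  with bound show ?thesis
    by (intro integrableI_nonneg) auto
qed

theorem proposition3p3:
  fixes M :: "'a measure"
    and \<eta> \<epsilon> \<sigma> :: "int \<Rightarrow> 'a \<Rightarrow> real"
    and \<omega> \<alpha>p \<alpha>m \<beta> s :: real
  assumes "prob_space M"
    and "iid_process M \<eta>"
    and "integrable M (\<eta> 0)" and "integral\<^sup>L M (\<eta> 0) = 0"
    and "integrable M (\<lambda>w. (\<eta> 0 w)\<^sup>2)" and "integral\<^sup>L M (\<lambda>w. (\<eta> 0 w)\<^sup>2) = 1"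
    and "(\<integral>\<^sup>+ w. e2ennreal (elog_plus \<bar>elog (ereal ((\<eta> 0 w)\<^sup>2))\<bar>) \<partial>M) < \<infinity>"
    and "s > 0"
    and "integrable M (\<lambda>w. \<bar>\<eta> 0 w\<bar> powr (2 * s))"
    and "\<beta> + \<alpha>p \<in> {0<..<1}" and "\<beta> + \<alpha>m \<in> {0<..<1}"
    and "min \<alpha>p \<alpha>m > 0"
    and "log_garch_11_solution M \<eta> \<omega> \<alpha>p \<alpha>m \<beta> \<epsilon> \<sigma>"
    and "strictly_stationary M (\<lambda>t w. (\<epsilon> t w, \<sigma> t w))"
  shows "integrable M (\<lambda>w. ((\<sigma> 0 w)\<^sup>2) powr (s / max \<alpha>p \<alpha>m))
       \<and> integrable M (\<lambda>w. \<bar>\<epsilon> 0 w\<bar> powr (2 * s / max (max \<alpha>p \<alpha>m) 1))"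
proof -
  interpret prob_space M by fact
  note \<eta> [measurable] = iid_process_measurable[OF assms(1,2)]
  have \<alpha>: "0 < \<alpha>p" "0 < \<alpha>m" and s: "0 < s"
    using assms(8,12) by auto
  note moment = log_garch_moment[OF assms(1,2,7,9,10,11) \<alpha> assms(13,14)]
  note [measurable] = strictly_stationary_Pair_measurable[OF assms(14)]
  have order: "0 \<le> s / c" "s / c * \<alpha>p \<le> s" "s / c * \<alpha>m \<le> s" if "max \<alpha>p \<alpha>m \<le> c" for c
    using that \<alpha> s by (auto simp: pos_divide_le_eq mult_left_mono)
  \<comment> \<open>The \<open>1\<close> in the maximum ensures \<open>r \<le> s\<close>, so
    \<open>r\<close> is admissible both as the order \<open>p\<close> for the volatility and as the
    order \<open>q\<close> for the innovation.\<close>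
  define r where "r = s / max (max \<alpha>p \<alpha>m) 1"
  have r: "0 \<le> r" "r \<le> s" "r * \<alpha>p \<le> s" "r * \<alpha>m \<le> s"
    using order[of "max (max \<alpha>p \<alpha>m) 1"] s by (auto simp: r_def divide_le_eq mult_le_cancel_left1)
  have nz: "AE w in M. \<eta> 0 w \<noteq> 0"
    using AE_nonzero_if_log_moment[OF \<eta> assms(7)] .
  show ?thesis
  proof
    \<comment> \<open>Since \<open>0 powr 0 = 0\<close>, the extra factor equals \<open>1\<close>
      only where \<open>\<eta> 0 w \<noteq> 0\<close>, hence the appeal to \<open>nz\<close> when it
      is removed.\<close>
    have "integrable M (\<lambda>w. ((\<sigma> 0 w)\<^sup>2) powr (s / max \<alpha>p \<alpha>m) * \<bar>\<eta> 0 w\<bar> powr (2 * 0))"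
      using order[of "max \<alpha>p \<alpha>m"] s by (intro moment) auto
    then show "integrable M (\<lambda>w. ((\<sigma> 0 w)\<^sup>2) powr (s / max \<alpha>p \<alpha>m))"
      by (rule integrable_cong_AE_imp) (use nz in \<open>auto elim!: eventually_mono\<close>)
  next
    have sol: "AE w in M. \<sigma> 0 w > 0 \<and> \<epsilon> 0 w = \<sigma> 0 w * \<eta> 0 w"
      using assms(13) unfolding log_garch_11_solution_def by (auto elim!: allE[of _ 0] eventually_mono)
    have "integrable M (\<lambda>w. ((\<sigma> 0 w)\<^sup>2) powr r * \<bar>\<eta> 0 w\<bar> powr (2 * r))"
      using r by (intro moment) auto
    then have "integrable M (\<lambda>w. \<bar>\<epsilon> 0 w\<bar> powr (2 * r))"
    proof (rule integrable_cong_AE_imp)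
      show "AE w in M. ((\<sigma> 0 w)\<^sup>2) powr r * \<bar>\<eta> 0 w\<bar> powr (2 * r) = \<bar>\<epsilon> 0 w\<bar> powr (2 * r)"
        using sol
      proof eventually_elim
        case (elim w)
        then have "((\<sigma> 0 w)\<^sup>2) powr r = \<bar>\<sigma> 0 w\<bar> powr (2 * r)"
          by (simp add: powr_powr flip: powr_numeral)
        with elim show ?case
          by (simp add: abs_mult powr_mult)
      qed
    qed measurable
    then show "integrable M (\<lambda>w. \<bar>\<epsilon> 0 w\<bar> powr (2 * s / max (max \<alpha>p \<alpha>m) 1))"
      by (simp add: r_def)
  qed
qed

end
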